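(* Let $\mathbb G$ be a group endowed with a symmetric length function $|\cdot|$. Let $(S_n)_{n\ge1}$ be i.i.d. $\mathbb G$-valued random variables with law $\mu$, and set $X_n=S_1\cdots S_n$. If there exist an event $E$ with $\mathbb P(E)>0$ and $v<\infty$ such that $$\frac{|X_n|}{n}\longrightarrow v\quad\text{on } E,$$ then $\mathbb E|S_1|<\infty$ (that is, $\mathbb E|X_1|<\infty$).
   Context: A symmetric length function is a function $|\cdot|:\mathbb G\to[0,\infty)$ with $|gh|\le|g|+|h|$ and $|g|=|g^{-1}|$ for all $g,h\in\mathbb G$ (e.g. the word length of a symmetric generating set). The quantities $|S_n|$ and $|X_n|$ are understood to be measurable (automatic when $\mathbb G$ is countable). *)

theory Defs
  imports "HOL-Probability.Probability" "HOL-Algebra.Group"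
begin

(* The normalisation l \<one> = 0 is deliberately not required. *)
definition symmetric_length :: "('g, 'b) monoid_scheme \<Rightarrow> ('g \<Rightarrow> real) \<Rightarrow> bool" where
  "symmetric_length G l \<longleftrightarrow>
     (\<forall>g\<in>carrier G. 0 \<le> l g) \<and>
     (\<forall>g\<in>carrier G. \<forall>h\<in>carrier G. l (g \<otimes>\<^bsub>G\<^esub> h) \<le> l g + l h) \<and>
     (\<forall>g\<in>carrier G. l (inv\<^bsub>G\<^esub> g) = l g)"

(* X_n = S_1 ... S_n, new increments multiplied on the right; S 0 is never used. *)
primrec random_walk ::
  "('g, 'b) monoid_scheme \<Rightarrow> (nat \<Rightarrow> 'w \<Rightarrow> 'g) \<Rightarrow> nat \<Rightarrow> 'w \<Rightarrow> 'g" where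
  "random_walk G S 0 w = \<one>\<^bsub>G\<^esub>"
| "random_walk G S (Suc n) w = random_walk G S n w \<otimes>\<^bsub>G\<^esub> S (Suc n) w"

(* The measure \<mu> carries both the sigma-algebra on the group and the common law.
   Independence includes measurability of each S n, n \<ge> 1, from M to \<mu>. *)
definition iid_with_law :: "'w measure \<Rightarrow> 'g measure \<Rightarrow> (nat \<Rightarrow> 'w \<Rightarrow> 'g) \<Rightarrow> bool" where
  "iid_with_law M \<mu> S \<longleftrightarrow>
     prob_space.indep_vars M (\<lambda>_. \<mu>) S {1..} \<and> (\<forall>n\<ge>1. distr M \<mu> (S n) = \<mu>)"

end

theory Submission
  imports Defs
begin

text \<open>
  The idea is that no single increment can be much longer than the walk just before and just
  after it. Since \<open>S\<^sub>n\<^sub>+\<^sub>1 = X\<^sub>n\<inverse> X\<^sub>n\<^sub>+\<^sub>1\<close>, symmetry and subadditivity give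
  \<open>l S\<^sub>n\<^sub>+\<^sub>1 \<le> l X\<^sub>n + l X\<^sub>n\<^sub>+\<^sub>1\<close> (\<open>symmetric_length_increment\<close>). If \<open>l X\<^sub>n / n\<close> converges, the
  lengths of the walk grow at most linearly, so along such a path the increments satisfy
  \<open>l S\<^sub>n < K n\<close> for all large \<open>n\<close>, with a constant \<open>K\<close> that depends only on the limit
  (\<open>eventually_increment_less\<close>).

  The real random variables \<open>l S\<^sub>n\<close> are i.i.d., so the events \<open>l S\<^sub>n < K n\<close> are independent. By the
  second half of the Borel--Cantelli lemma, they can eventually all occur with positive probability
  only if the probabilities of their complements are summable
  (\<open>summable_prob_compl_of_eventually\<close>). As the increments have a common law, this says
  \<open>(\<Sum>n. P (l S\<^sub>1 \<ge> K n)) < \<infinity>\<close>, which is integrability of \<open>l S\<^sub>1\<close>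
  (\<open>integrable_of_summable_tail\<close>).
\<close>

text \<open>
  The product of finitely many of the probabilities \<open>P (F i)\<close> is at most
  \<open>exp (- (\<Sum>i. 1 - P (F i)))\<close>. By independence this product is the probability of an intersection.
  Since \<open>E\<close> has positive probability, so does already the part of \<open>E\<close> on which \<open>F\<close> holds from some
  fixed index on; beyond that index this part lies in every such intersection, and its probability
  bounds the partial sums.
\<close>

lemma (in prob_space) summable_prob_compl_of_eventually:
  fixes F :: "nat \<Rightarrow> 'a set"
  assumes indep: "indep_events F {k..}"
    and E: "E \<in> events" "prob E > 0"
    and ev: "\<And>w. w \<in> E \<Longrightarrow> eventually (\<lambda>n. w \<in> F n) sequentially"
  shows "summable (\<lambda>n. 1 - prob (F n))"
proof -
  have F: "F n \<in> events" if "n \<ge> k" for n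
    using indep that by (auto simp: indep_events_def)
  define H where "H N = E \<inter> (\<Inter>n\<in>{N + k..}. F n)" for N
  have H: "H N \<in> events" for N
    unfolding H_def using E(1) F by (intro sets.Int sets.countable_INT') auto
  have "E \<subseteq> (\<Union>N. H N)"
  proof
    fix w assume "w \<in> E"
    with ev obtain N where "\<And>n. n \<ge> N \<Longrightarrow> w \<in> F n"
      unfolding eventually_sequentially by blast
    with \<open>w \<in> E\<close> have "w \<in> H N" by (simp add: H_def)
    then show "w \<in> (\<Union>N. H N)" by blast
  qed
  have "\<exists>N. prob (H N) > 0"
  proof (rule ccontr)
    assume "\<nexists>N. prob (H N) > 0"
    then have "prob (H N) = 0" for N
      by (simp add: not_less measure_le_0_iff)
    then have "H N \<in> null_sets M" for N
      using H[of N] by (simp add: null_sets_def emeasure_eq_measure)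
    then have "(\<Union>N. H N) \<in> null_sets M" by blast
    then have "E \<in> null_sets M" using E(1) \<open>E \<subseteq> (\<Union>N. H N)\<close> by (rule null_sets_subset)
    with E(2) show False by (simp add: measure_eq_0_null_sets)
  qed
  then obtain N where N: "prob (H N) > 0" ..
  have "(\<Sum>i<n. 1 - prob (F (i + (N + k)))) \<le> - ln (prob (H N))" for n
  proof (cases "n = 0")
    case True
    then show ?thesis using N by simp
  next
    case False
    let ?J = "{N + k..<n + (N + k)}"
    have "prob (H N) \<le> prob (\<Inter>i\<in>?J. F i)"
      using False F by (intro finite_measure_mono sets.finite_INT) (auto simp: H_def)
    also have "\<dots> = (\<Prod>i\<in>?J. prob (F i))"
    proof -
      have "?J \<subseteq> {k..}" "?J \<noteq> {}" "finite ?J" using False by auto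
      then show ?thesis using indep unfolding indep_events_def by blast
    qed
    also have "\<dots> \<le> (\<Prod>i\<in>?J. exp (- (1 - prob (F i))))"
      by (intro prod_mono conjI measure_nonneg order_trans[OF _ exp_ge_add_one_self]) simp
    also have "\<dots> = exp (- (\<Sum>i\<in>?J. 1 - prob (F i)))"
      by (simp only: exp_sum[symmetric] sum_negf finite_atLeastLessThan)
    finally have "ln (prob (H N)) \<le> - (\<Sum>i\<in>?J. 1 - prob (F i))"
      using N by (metis ln_exp ln_mono)
    moreover have "(\<Sum>i\<in>?J. 1 - prob (F i)) = (\<Sum>i<n. 1 - prob (F (i + (N + k))))"
      using sum.shift_bounds_nat_ivl[of "\<lambda>i. 1 - prob (F i)" 0 "N + k" n]
      by (simp add: atLeast0LessThan)
    ultimately show ?thesis by simp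
  qed
  then have "summable (\<lambda>i. 1 - prob (F (i + (N + k))))"
    by (intro summableI_nonneg_bounded) simp_all
  then show ?thesis
    by (subst (asm) summable_iff_shift[of "\<lambda>i. 1 - prob (F i)"])
qed

text \<open>
  Up to a bounded error, \<open>Y\<close> is \<open>K\<close> times the natural number \<open>\<lfloor>Y / K\<rfloor>\<close>, whose expectation is the sum
  of its tail probabilities.
\<close>

lemma (in prob_space) integrable_of_summable_tail:
  fixes Y :: "'a \<Rightarrow> real"
  assumes Y: "Y \<in> borel_measurable M" "\<And>w. w \<in> space M \<Longrightarrow> 0 \<le> Y w"
    and K: "K > 0"
    and tail: "summable (\<lambda>n. prob {w \<in> space M. K * real (Suc n) \<le> Y w})"
  shows "integrable M Y"
proof -
  define f where "f w = nat \<lfloor>Y w / K\<rfloor>" for w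
  have f [measurable]: "f \<in> measurable M (count_space UNIV)"
    unfolding f_def using Y(1) by measurable
  have less_f: "t < f w \<longleftrightarrow> K * real (Suc t) \<le> Y w" for t w
  proof -
    have "t < f w \<longleftrightarrow> int (Suc t) \<le> \<lfloor>Y w / K\<rfloor>" by (auto simp: f_def)
    also have "\<dots> \<longleftrightarrow> real (Suc t) \<le> Y w / K" by (simp add: le_floor_iff)
    also have "\<dots> \<longleftrightarrow> K * real (Suc t) \<le> Y w"
      using K by (simp add: pos_le_divide_eq mult.commute)
    finally show ?thesis .
  qed
  have "(\<integral>\<^sup>+w. ennreal (of_nat (f w)) \<partial>M) = (\<Sum>t. emeasure M {w \<in> space M. t < f w})"
    using nn_integral_nat_function[OF f] by (simp add: ennreal_of_nat_eq_real_of_nat)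
  also have "\<dots> = (\<Sum>t. ennreal (prob {w \<in> space M. K * real (Suc t) \<le> Y w}))"
    by (simp only: less_f emeasure_eq_measure)
  also have "\<dots> < \<infinity>"
    unfolding infinity_ennreal_def less_top[symmetric]
    by (rule ennreal_suminf_neq_top[OF tail]) simp
  finally have "integrable M (\<lambda>w. real (f w))"
    by (intro integrableI_nonneg) auto
  then have "integrable M (\<lambda>w. K * (real (f w) + 1))" by simp
  then show ?thesis
  proof (rule Bochner_Integration.integrable_bound)
    show "AE w in M. norm (Y w) \<le> norm (K * (real (f w) + 1))"
    proof (rule AE_I2)
      fix w assume "w \<in> space M"
      then show "norm (Y w) \<le> norm (K * (real (f w) + 1))"
        using less_f[of "f w" w] Y(2)[of w] K by (simp add: algebra_simps)
    qed
  qed (use Y in auto)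
qed

lemma symmetric_length_increment:
  fixes G (structure)
  assumes "group G" and l: "symmetric_length G l" and g: "g \<in> carrier G" and h: "h \<in> carrier G"
  shows "l h \<le> l g + l (g \<otimes> h)"
proof -
  interpret group G by fact
  have "l (inv g \<otimes> (g \<otimes> h)) \<le> l (inv g) + l (g \<otimes> h)"
    using l inv_closed[OF g] m_closed[OF g h] by (simp only: symmetric_length_def)
  moreover have "inv g \<otimes> (g \<otimes> h) = h"
    using g h by (simp add: m_assoc[symmetric])
  moreover have "l (inv g) = l g"
    using l g by (simp add: symmetric_length_def)
  ultimately show ?thesis by simp
qed

lemma random_walk_in_carrier:
  assumes "group G" and "\<And>n. n \<ge> 1 \<Longrightarrow> S n w \<in> carrier G"
  shows "random_walk G S n w \<in> carrier G"
proof -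
  interpret group G by fact
  show ?thesis using assms(2) by (induction n) auto
qed

lemma eventually_increment_less:
  assumes G: "group G" and l: "symmetric_length G l"
    and S: "\<And>n. n \<ge> 1 \<Longrightarrow> S n w \<in> carrier G"
    and lim: "(\<lambda>n. l (random_walk G S n w) / real n) \<longlonglongrightarrow> v"
  shows "eventually (\<lambda>n. l (S n w) < 2 * (\<bar>v\<bar> + 1) * real n) sequentially"
proof -
  have "eventually (\<lambda>n. l (random_walk G S n w) / real n < \<bar>v\<bar> + 1) sequentially"
    using lim by (rule order_tendstoD) simp
  then have walk: "eventually (\<lambda>n. l (random_walk G S n w) < (\<bar>v\<bar> + 1) * real n) sequentially"
    using eventually_gt_at_top[of 0] by eventually_elim (simp add: divide_simps mult.commute)
  then have walk_Suc:
    "eventually (\<lambda>n. l (random_walk G S (Suc n) w) < (\<bar>v\<bar> + 1) * real (Suc n)) sequentially"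
    by (subst eventually_sequentially_Suc)
  have "eventually (\<lambda>n. l (S (Suc n) w) < 2 * (\<bar>v\<bar> + 1) * real (Suc n)) sequentially"
    using walk walk_Suc
  proof eventually_elim
    case (elim n)
    have "l (S (Suc n) w) \<le> l (random_walk G S n w) + l (random_walk G S (Suc n) w)"
      using symmetric_length_increment[OF G l random_walk_in_carrier[of G S w n, OF G S] S[of "Suc n"]]
      by simp
    also have "\<dots> < (\<bar>v\<bar> + 1) * real n + (\<bar>v\<bar> + 1) * real (Suc n)"
      using elim by (rule add_strict_mono)
    also have "\<dots> \<le> 2 * (\<bar>v\<bar> + 1) * real (Suc n)"
      by (simp add: algebra_simps)
    finally show ?case .
  qed
  then show ?thesis by (subst (asm) eventually_sequentially_Suc)
qed

theorem theoremH:
  fixes G :: "('g, 'b) monoid_scheme"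
    and l :: "'g \<Rightarrow> real"
    and M :: "'w measure"
    and \<mu> :: "'g measure"
    and S :: "nat \<Rightarrow> 'w \<Rightarrow> 'g"
    and E :: "'w set"
    and v :: real
  assumes "group G"
    and "symmetric_length G l"
    and "prob_space M"
    and "space \<mu> = carrier G"
    and "iid_with_law M \<mu> S"
    and "l \<in> borel_measurable \<mu>"
    and "\<And>n. n \<ge> 1 \<Longrightarrow> (\<lambda>w. l (random_walk G S n w)) \<in> borel_measurable M"
    and "E \<in> sets M"
    and "measure M E > 0"
    and "\<And>w. w \<in> E \<Longrightarrow> (\<lambda>n. l (random_walk G S n w) / real n) \<longlonglongrightarrow> v"
  shows "integrable M (\<lambda>w. l (S 1 w))"
proof -
  interpret prob_space M by fact
  note [measurable] = \<open>l \<in> borel_measurable \<mu>\<close>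
  define K where "K = 2 * (\<bar>v\<bar> + 1)"
  have "K > 0" by (simp add: K_def)
  have indep: "indep_vars (\<lambda>_. \<mu>) S {1..}"
    and law: "\<And>n. n \<ge> 1 \<Longrightarrow> distr M \<mu> (S n) = \<mu>"
    using \<open>iid_with_law M \<mu> S\<close> by (auto simp: iid_with_law_def)
  have S: "S n \<in> measurable M \<mu>" if "n \<ge> 1" for n
    using indep that by (auto simp: indep_vars_def)
  have carrier: "S n w \<in> carrier G" if "w \<in> space M" "n \<ge> 1" for n w
    using measurable_space[OF S[OF that(2)] that(1)] \<open>space \<mu> = carrier G\<close> by simp
  define F where "F n = {w \<in> space M. l (S n w) < K * real n}" for n
  have "indep_events F {1..}"
    unfolding F_def by (intro indep_eventsI_indep_vars[OF indep]) measurable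
  moreover have "eventually (\<lambda>n. w \<in> F n) sequentially" if "w \<in> E" for w
  proof -
    have "w \<in> space M" using that \<open>E \<in> sets M\<close> sets.sets_into_space by blast
    then show ?thesis
      using eventually_increment_less[OF assms(1,2) carrier assms(10)[OF that]]
      by (simp add: F_def K_def)
  qed
  ultimately have "summable (\<lambda>n. 1 - prob (F n))"
    by (rule summable_prob_compl_of_eventually[OF _ assms(8,9)])
  then have "summable (\<lambda>n. 1 - prob (F (Suc n)))"
    by (subst summable_Suc_iff)
  moreover have "1 - prob (F (Suc n)) = prob {w \<in> space M. K * real (Suc n) \<le> l (S 1 w)}" for n
  proof -
    let ?B = "{g \<in> space \<mu>. K * real (Suc n) \<le> l g}"
    have B: "?B \<in> sets \<mu>" by measurable
    have prob_B: "prob (S m -` ?B \<inter> space M) = measure \<mu> ?B" if "m \<ge> 1" for m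
      using measure_distr[OF S[OF that] B] law[OF that] by simp
    have vimage_B: "S m -` ?B \<inter> space M = {w \<in> space M. K * real (Suc n) \<le> l (S m w)}"
      if "m \<ge> 1" for m
      using measurable_space[OF S[OF that]] by auto
    have "F (Suc n) \<in> events"
      using \<open>indep_events F {1..}\<close> by (auto simp: indep_events_def)
    then have "1 - prob (F (Suc n)) = prob (space M - F (Suc n))"
      by (simp add: prob_compl)
    also have "space M - F (Suc n) = S (Suc n) -` ?B \<inter> space M"
      by (subst vimage_B) (auto simp: F_def)
    finally show ?thesis
      using prob_B[of "Suc n"] prob_B[of 1] vimage_B[of 1] by simp
  qed
  ultimately have tail: "summable (\<lambda>n. prob {w \<in> space M. K * real (Suc n) \<le> l (S 1 w)})"
    by simp
  have "(\<lambda>w. l (S 1 w)) \<in> borel_measurable M"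
    by (rule measurable_compose[OF S]) simp_all
  moreover have "0 \<le> l (S 1 w)" if "w \<in> space M" for w
    using carrier[OF that, of 1] \<open>symmetric_length G l\<close> by (simp add: symmetric_length_def)
  ultimately show ?thesis
    using \<open>K > 0\<close> tail by (rule integrable_of_summable_tail)
qed

end
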